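(* Let $(X,d)$ be a nonempty metric space, let $T:X\to X$ be asymptotically regular, and let $\mathbf{m}:X\times X\to[0,\infty)$ be a function. Suppose that: (i) for any $\epsilon>0$ there exist $\delta>0$ and $N\in\mathbb{N}_0$ such that, for all $x,y\in X$, $$\mathbf{m}(T^Nx,T^Ny)<\delta+\epsilon \ \Longrightarrow\ d(T^{N+1}x,T^{N+1}y)\leq\epsilon;$$ (ii) for every $x\in X$, writing $x_n=T^nx$ ($n\in\mathbb{N}_0$), one has $$\limsup_{n\to\infty}\mathbf{m}(x_{p_n},x_{q_n})\leq\limsup_{n\to\infty}d(x_{p_n},x_{q_n})$$ for any two subsequences $\{x_{p_n}\}$ and $\{x_{q_n}\}$ of $\{x_n\}$. Then, for every $x\in X$, the sequence $\{T^nx\}$ is Cauchy. Moreover, if $X$ is complete, $T$ is continuous, and $d(T^nx,T^ny)\to 0$ for all $x,y\in X$, then $T$ has a unique fixed point $z$, and $T^nx\to z$ for every $x\in X$.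
   Context: $\mathbb{N}_0=\{0,1,2,\dots\}$, and all sequences are indexed by $\mathbb{N}_0$. A self-map $T$ of $X$ is asymptotically regular if $d(T^nx,T^{n+1}x)\to 0$ for each $x\in X$. A subsequence $\{x_{p_n}\}$ is given by a strictly increasing sequence $\{p_n\}$ of nonnegative integers. Limits superior are taken in $[0,\infty]$. *)

theory Defs
  imports "HOL-Analysis.Analysis"
begin

definition asymptotically_regular :: "('a::metric_space \<Rightarrow> 'a) \<Rightarrow> bool" where
  "asymptotically_regular T \<longleftrightarrow>
     (\<forall>x. (\<lambda>n. dist ((T ^^ n) x) ((T ^^ Suc n) x)) \<longlonglongrightarrow> 0)"

end

theory Submission
  imports Defs
begin

text \<open>
  If an orbit \<open>x\<close> is not Cauchy, there are \<open>\<epsilon> > 0\<close> and arbitrarily large \<open>p < q\<close> with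
  \<open>d(x\<^sub>p, x\<^sub>q) > \<epsilon>\<close>; taking \<open>q\<close> least, \<open>d(x\<^sub>p, x\<^bsub>q-1\<^esub>) \<le> \<epsilon>\<close>. Stepping back once,
  \<open>d(x\<^bsub>p-1\<^esub>, x\<^bsub>q-1\<^esub>) \<le> \<epsilon> + d(x\<^bsub>p-1\<^esub>, x\<^sub>p)\<close>, whose limit superior is at most \<open>\<epsilon>\<close> by
  asymptotic regularity. By (ii) the values \<open>m(x\<^bsub>p-1\<^esub>, x\<^bsub>q-1\<^esub>)\<close> are eventually below \<open>\<epsilon> + \<delta>\<close>,
  and (i) yields \<open>d(x\<^sub>p, x\<^sub>q) \<le> \<epsilon>\<close>, a contradiction.
\<close>

text \<open>The indices \<open>a\<close>, \<open>b\<close> are the predecessors of the far pair,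
  since a contraction step will lead from \<open>(a, b)\<close> to \<open>(Suc a, Suc b)\<close>.
  One \<epsilon> must serve every lower bound \<open>N\<close>, because condition (i) supplies its
  \<open>N\<close> only after \<epsilon> is fixed.\<close>

lemma not_Cauchy_obtain_subseqs:
  fixes u :: "nat \<Rightarrow> 'a::metric_space"
  assumes "\<not> Cauchy u"
  obtains \<epsilon> where "\<epsilon> > 0"
    and "\<And>N. \<exists>a b :: nat \<Rightarrow> nat. strict_mono a \<and> strict_mono b \<and> (\<forall>k. N \<le> a k \<and> a k < b k) \<and>
           (\<forall>k. dist (u (a k)) (u (b k)) \<le> \<epsilon> + dist (u (a k)) (u (Suc (a k)))) \<and>
           (\<forall>k. dist (u (Suc (a k))) (u (Suc (b k))) > \<epsilon>)"
proof -
  from assms obtain e where e: "e > 0"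
    and far: "\<And>k. \<exists>p\<ge>k. \<exists>q>p. \<not> dist (u p) (u q) < e"
    unfolding Cauchy_altdef by blast
  \<comment> \<open>The negated Cauchy property only gives distances of at least \<open>e\<close>;
    halving turns this into the strict bound \<open>> \<epsilon>\<close>.\<close>
  define \<epsilon> where "\<epsilon> = e / 2"
  have \<epsilon>: "\<epsilon> > 0" using e by (simp add: \<epsilon>_def)
  have "\<exists>a b. k \<le> a \<and> a < b \<and> dist (u a) (u b) \<le> \<epsilon> + dist (u a) (u (Suc a)) \<and>
          dist (u (Suc a)) (u (Suc b)) > \<epsilon>" for k
  proof -
    \<comment> \<open>Asking for \<open>Suc k\<close> ensures that \<open>p\<close> has a
      predecessor \<open>a\<close> with \<open>k \<le> a\<close>.\<close>
    obtain p q0 where p: "p \<ge> Suc k" and q0: "q0 > p" "\<not> dist (u p) (u q0) < e"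
      using far by blast
    let ?P = "\<lambda>q. q > p \<and> dist (u p) (u q) > \<epsilon>"
    define q where "q = (LEAST q. ?P q)"
    have "?P q0" using q0 e by (simp add: \<epsilon>_def)
    then have q: "?P q" unfolding q_def by (rule LeastI)
    obtain a where a: "p = Suc a" using p by (cases p) auto
    obtain b where b: "q = Suc b" using q by (cases q) auto
    have "\<not> ?P b" unfolding b[symmetric] using not_less_Least[of b ?P] b q_def by auto
    \<comment> \<open>Minimality of \<open>q\<close> leaves two cases: \<open>b = p\<close>, where
      the distance is 0, or \<open>p < b\<close> with distance at most \<epsilon>.\<close>
    then have "dist (u p) (u b) \<le> \<epsilon>"
      using q b \<epsilon> by (cases "b = p") auto
    then have "dist (u a) (u b) \<le> \<epsilon> + dist (u a) (u (Suc a))"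
      using dist_triangle[of "u a" "u b" "u p"] a by simp
    then show ?thesis using p q a b by auto
  qed
  then obtain A B where AB: "\<And>k. k \<le> A k" "\<And>k. A k < B k"
      "\<And>k. dist (u (A k)) (u (B k)) \<le> \<epsilon> + dist (u (A k)) (u (Suc (A k)))"
      "\<And>k. dist (u (Suc (A k))) (u (Suc (B k))) > \<epsilon>"
    by metis
  have "\<exists>a b :: nat \<Rightarrow> nat. strict_mono a \<and> strict_mono b \<and> (\<forall>k. N \<le> a k \<and> a k < b k) \<and>
           (\<forall>k. dist (u (a k)) (u (b k)) \<le> \<epsilon> + dist (u (a k)) (u (Suc (a k)))) \<and>
           (\<forall>k. dist (u (Suc (a k))) (u (Suc (b k))) > \<epsilon>)" for N
  proof -
    \<comment> \<open>Each new starting point lies beyond the previous \<open>B\<close>, so the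
      pairs occupy disjoint blocks: \<open>A (r k) < B (r k) < A (r (Suc k))\<close>. Hence both
      index sequences increase strictly.\<close>
    define r where "r k = ((\<lambda>i. Suc (B i)) ^^ k) N" for k
    have r_Suc: "r (Suc k) = Suc (B (r k))" for k by (simp add: r_def)
    have AB_Suc: "B (r k) < A (r (Suc k))" for k
      using AB(1)[of "r (Suc k)"] by (simp add: r_Suc)
    have r_ge: "N \<le> r k" for k
    proof (induction k)
      case (Suc k)
      then show ?case using AB(1,2)[of "r k"] by (simp add: r_Suc)
    qed (simp add: r_def)
    have "strict_mono (A \<circ> r)" "strict_mono (B \<circ> r)"
      using AB(2) AB_Suc by (auto simp: strict_mono_Suc_iff intro: less_trans)
    moreover have "N \<le> A (r k)" for k
      using r_ge AB(1) by (rule order_trans)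
    ultimately show ?thesis
      using AB
      by - (rule exI[of _ "A \<circ> r"], rule exI[of _ "B \<circ> r"], simp)
  qed
  with \<epsilon> show thesis by (rule that)
qed

text \<open>This turns condition (ii) into a pointwise bound: the limit superior of \<open>f\<close>
  is at most that of \<open>h\<close>, which is \<open>c\<close>, and \<open>c < c'\<close>.\<close>

lemma limsup_le_imp_eventually_less:
  fixes f g h :: "nat \<Rightarrow> real"
  assumes "limsup (\<lambda>n. ereal (f n)) \<le> limsup (\<lambda>n. ereal (g n))"
    and "\<And>n. g n \<le> h n" and "h \<longlonglongrightarrow> c" and "c < c'"
  shows "\<forall>\<^sub>F n in sequentially. f n < c'"
proof -
  have "limsup (\<lambda>n. ereal (g n)) \<le> limsup (\<lambda>n. ereal (h n))"
    using assms(2) by (intro Limsup_mono) auto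
  also have "\<dots> = ereal c"
    using assms(3) by (intro lim_imp_Limsup) auto
  finally have "limsup (\<lambda>n. ereal (f n)) < ereal c'"
    using assms(1,4) by (meson less_ereal.simps(1) order.trans order.strict_trans1)
  then show ?thesis
    by (auto dest: Limsup_lessD)
qed

lemma Cauchy_orbit:
  fixes T :: "'a::metric_space \<Rightarrow> 'a" and m :: "'a \<times> 'a \<Rightarrow> real"
  assumes regular: "(\<lambda>n. dist ((T ^^ n) x) ((T ^^ Suc n) x)) \<longlonglongrightarrow> 0"
    and contractive: "\<And>\<epsilon>::real. \<epsilon> > 0 \<Longrightarrow>
          \<exists>\<delta>>0. \<exists>N::nat. \<forall>x y. m ((T ^^ N) x, (T ^^ N) y) < \<delta> + \<epsilon> \<longrightarrow>
            dist ((T ^^ (N + 1)) x) ((T ^^ (N + 1)) y) \<le> \<epsilon>"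
    and limsup_le: "\<And>(p :: nat \<Rightarrow> nat) (q :: nat \<Rightarrow> nat). strict_mono p \<Longrightarrow> strict_mono q \<Longrightarrow>
          limsup (\<lambda>n. ereal (m ((T ^^ p n) x, (T ^^ q n) x)))
            \<le> limsup (\<lambda>n. ereal (dist ((T ^^ p n) x) ((T ^^ q n) x)))"
  shows "Cauchy (\<lambda>n. (T ^^ n) x)"
proof (rule ccontr)
  let ?u = "\<lambda>n. (T ^^ n) x"
  assume "\<not> Cauchy ?u"
  then obtain \<epsilon> where \<epsilon>: "\<epsilon> > 0"
    and subseqs: "\<And>N. \<exists>a b :: nat \<Rightarrow> nat. strict_mono a \<and> strict_mono b \<and> (\<forall>k. N \<le> a k \<and> a k < b k) \<and>
           (\<forall>k. dist (?u (a k)) (?u (b k)) \<le> \<epsilon> + dist (?u (a k)) (?u (Suc (a k)))) \<and>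
           (\<forall>k. dist (?u (Suc (a k))) (?u (Suc (b k))) > \<epsilon>)"
    by (rule not_Cauchy_obtain_subseqs) blast
  obtain \<delta> N where "\<delta> > 0"
    and N: "\<And>x y. m ((T ^^ N) x, (T ^^ N) y) < \<delta> + \<epsilon> \<Longrightarrow>
            dist ((T ^^ (N + 1)) x) ((T ^^ (N + 1)) y) \<le> \<epsilon>"
    using contractive[OF \<epsilon>] by blast
  obtain a b :: "nat \<Rightarrow> nat" where mono: "strict_mono a" "strict_mono b"
    and ge: "\<And>k. N \<le> a k" "\<And>k. a k < b k"
    and near: "\<And>k. dist (?u (a k)) (?u (b k)) \<le> \<epsilon> + dist (?u (a k)) (?u (Suc (a k)))"
    and far: "\<And>k. dist (?u (Suc (a k))) (?u (Suc (b k))) > \<epsilon>"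
    using subseqs[of N] by blast
  have "(\<lambda>k. dist (?u (a k)) (?u (Suc (a k)))) \<longlonglongrightarrow> 0"
    using LIMSEQ_subseq_LIMSEQ[OF regular mono(1)] by (simp add: o_def)
  then have "(\<lambda>k. \<epsilon> + dist (?u (a k)) (?u (Suc (a k)))) \<longlonglongrightarrow> \<epsilon>"
    using tendsto_add[OF tendsto_const] by fastforce
  then have "\<forall>\<^sub>F k in sequentially. m (?u (a k), ?u (b k)) < \<delta> + \<epsilon>"
    using \<open>\<delta> > 0\<close> by (intro limsup_le_imp_eventually_less[OF limsup_le[OF mono] near]) auto
  then obtain k where k: "m (?u (a k), ?u (b k)) < \<delta> + \<epsilon>"
    by (auto simp: eventually_sequentially)
  \<comment> \<open>Condition (i) speaks of \<open>N\<close>-th iterates, so \<open>N\<close> steps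
    are taken back along the orbit. As \<open>N \<le> a k < b k\<close>, the subtractions are not
    truncated, and the iterates of order \<open>N + 1\<close> are the far pair.\<close>
  define y z where "y = ?u (a k - N)" and "z = ?u (b k - N)"
  have "(T ^^ N) y = ?u (a k)" "(T ^^ N) z = ?u (b k)"
    using ge(1)[of k] ge(2)[of k] funpow_add[of N "a k - N" T] funpow_add[of N "b k - N" T]
    by (simp_all add: y_def z_def)
  then show False
    using N[of y z] k far[of k] by simp
qed

lemma funpow_fixpoint: "f x = x \<Longrightarrow> (f ^^ n) x = x"
  by (induction n) auto

lemma orbit_limit_fixpoint:
  fixes T :: "'a::t2_space \<Rightarrow> 'a"
  assumes "isCont T z" and "(\<lambda>n. (T ^^ n) x) \<longlonglongrightarrow> z"
  shows "T z = z"
proof -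
  have "(\<lambda>n. T ((T ^^ n) x)) \<longlonglongrightarrow> T z"
    using assms by (rule isCont_tendsto_compose)
  moreover have "(\<lambda>n. T ((T ^^ n) x)) \<longlonglongrightarrow> z"
    using LIMSEQ_Suc[OF assms(2)] by simp
  ultimately show ?thesis by (rule LIMSEQ_unique)
qed

theorem theorem3p6:
  fixes T :: "'a::metric_space \<Rightarrow> 'a"
    and m :: "'a \<times> 'a \<Rightarrow> real"
  assumes regular: "asymptotically_regular T"
    and m_nonneg: "\<And>x y. m (x, y) \<ge> 0"
    and contractive: "\<And>\<epsilon>::real. \<epsilon> > 0 \<Longrightarrow>
          \<exists>\<delta>>0. \<exists>N::nat. \<forall>x y. m ((T ^^ N) x, (T ^^ N) y) < \<delta> + \<epsilon> \<longrightarrow>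
            dist ((T ^^ (N + 1)) x) ((T ^^ (N + 1)) y) \<le> \<epsilon>"
    and limsup_le: "\<And>x (p :: nat \<Rightarrow> nat) (q :: nat \<Rightarrow> nat). strict_mono p \<Longrightarrow> strict_mono q \<Longrightarrow>
          limsup (\<lambda>n. ereal (m ((T ^^ p n) x, (T ^^ q n) x)))
            \<le> limsup (\<lambda>n. ereal (dist ((T ^^ p n) x) ((T ^^ q n) x)))"
  shows "(\<forall>x. Cauchy (\<lambda>n. (T ^^ n) x)) \<and>
    (complete (UNIV :: 'a set) \<and> continuous_on UNIV T \<and>
       (\<forall>x y. (\<lambda>n. dist ((T ^^ n) x) ((T ^^ n) y)) \<longlonglongrightarrow> 0) \<longrightarrow>
     (\<exists>z. T z = z \<and> (\<forall>w. T w = w \<longrightarrow> w = z) \<and> (\<forall>x. (\<lambda>n. (T ^^ n) x) \<longlonglongrightarrow> z)))"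
proof (intro conjI impI)
  show cauchy: "\<forall>x. Cauchy (\<lambda>n. (T ^^ n) x)"
    using regular unfolding asymptotically_regular_def
    by (intro allI Cauchy_orbit[of T _ m, OF _ contractive limsup_le]) blast+
  assume asm: "complete (UNIV :: 'a set) \<and> continuous_on UNIV T \<and>
       (\<forall>x y. (\<lambda>n. dist ((T ^^ n) x) ((T ^^ n) y)) \<longlonglongrightarrow> 0)"
  \<comment> \<open>Types are inhabited, so a starting point exists; its orbit limit is the
    candidate.\<close>
  fix x0 :: 'a
  obtain z where lim: "(\<lambda>n. (T ^^ n) x0) \<longlonglongrightarrow> z"
    using cauchy asm unfolding complete_def by blast
  have fix_z: "T z = z"
    using asm lim by (auto intro: orbit_limit_fixpoint simp: continuous_on_eq_continuous_at)
  have to_z: "(\<lambda>n. (T ^^ n) x) \<longlonglongrightarrow> z" for x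
  proof -
    have "(\<lambda>n. dist ((T ^^ n) x) ((T ^^ n) z)) \<longlonglongrightarrow> 0" using asm by blast
    then show ?thesis
      by (subst tendsto_dist_iff) (simp add: funpow_fixpoint[of T, OF fix_z])
  qed
  \<comment> \<open>A fixed point has a constant orbit, which must also converge to
    \<open>z\<close>.\<close>
  moreover have "w = z" if "T w = w" for w
    using to_z[of w] by (simp add: funpow_fixpoint[of T, OF that] LIMSEQ_const_iff)
  ultimately show "\<exists>z. T z = z \<and> (\<forall>w. T w = w \<longrightarrow> w = z) \<and> (\<forall>x. (\<lambda>n. (T ^^ n) x) \<longlonglongrightarrow> z)"
    using fix_z by blast
qed

end
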